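(* Let $a, b$ be relatively prime positive integers such that $\frac{6}{5} < \frac{a}{b} < \frac{5}{4}$ and $\frac{a}{b} \notin \{\frac{11}{9}, \frac{17}{14}\}$. Then the $a$-uniform morphism $\varphi$ on $\mathbb{Z}_{\geq 0}$ defined by $\varphi(n) = 0^{6 a-7 b-1} \, 1 \, 0^{-3 a+4 b-1} \, 1 \, 0^{-8 a+10 b-1} \, 1 \, 0^{6 a-7 b-1} \, (n+1)$ locates words of length $a$ and is $\frac{a}{b}$-power-free.
   Context: Words are indexed from position $0$; a factor is a contiguous subword; $c^m$ denotes $m$ copies of the letter $c$. For relatively prime positive integers $a,b$ and a nonempty word $v$ whose length is divisible by $b$, define $v^{a/b} = v^{\lfloor a/b \rfloor} v_0 v_1 \cdots v_{t-1}$, where $t = |v|\,(a/b - \lfloor a/b\rfloor)$; such a word is called an $\frac{a}{b}$-power. A word is $\frac{a}{b}$-power-free if none of its factors is an $\frac{a}{b}$-power. A morphism $\varphi$ on an alphabet $\Sigma$ is a map $\Sigma \to \Sigma^*$, extended to words by concatenation; it is $k$-uniform if all images have length $k$. A morphism is $\frac{a}{b}$-power-free if $\varphi(w)$ is $\frac{a}{b}$-power-free for every finite $\frac{a}{b}$-power-free word $w$. A $k$-uniform morphism $\varphi$ on $\Sigma$ locates words of length $\ell$ if for each word $x$ of length $\ell$ there is an integer $j$ such that, for all $w \in \Sigma^*$, every occurrence of $x$ as a factor of $\varphi(w)$ begins at a position congruent to $j$ modulo $k$. *)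

theory Defs
  imports Complex_Main "HOL-Library.Sublist" "HOL-Number_Theory.Cong"
begin

text \<open>
  Words are lists, indexed from 0; factors are given by \<^const>\<open>sublist\<close> (contiguous sublists).
  A morphism is given by its values on letters. Alphabets are types.
\<close>

text \<open>
  \<open>frac_power a b v\<close> is $v^{a/b}$, intended for coprime positive \<open>a\<close>, \<open>b\<close> and nonempty \<open>v\<close>
  with \<open>b dvd length v\<close>.
\<close>
definition frac_power :: "nat \<Rightarrow> nat \<Rightarrow> 'a list \<Rightarrow> 'a list" where
  "frac_power a b v = concat (replicate (a div b) v) @ take (length v * (a mod b) div b) v"

text \<open>The floor of \<open>a/b\<close> and the length $t = |v|\,(a/b - \lfloor a/b\rfloor)$ of the last part are computed
  exactly by the integer operations used above:\<close>
lemma frac_power_floor: "int (a div b) = \<lfloor>real a / real b\<rfloor>"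
  by (simp add: floor_divide_of_nat_eq)

lemma frac_power_tail_length:
  assumes "0 < b" and "b dvd length v"
  shows "real (length v * (a mod b) div b)
         = real (length v) * (real a / real b - real_of_int \<lfloor>real a / real b\<rfloor>)"
proof -
  obtain m where m: "length v = b * m" using assms(2) by (auto elim: dvdE)
  have "real a = real b * real (a div b) + real (a mod b)"
    by (metis mult_div_mod_eq of_nat_add of_nat_mult)
  then have "real a / real b - real_of_int \<lfloor>real a / real b\<rfloor> = real (a mod b) / real b"
    unfolding floor_divide_of_nat_eq using assms(1) by (simp add: field_simps)
  moreover have "length v * (a mod b) div b = m * (a mod b)"
    using assms(1) by (simp add: m mult.assoc)
  ultimately show ?thesis
    using assms(1) by (simp add: m)
qed

definition is_frac_power :: "nat \<Rightarrow> nat \<Rightarrow> 'a list \<Rightarrow> bool" where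
  "is_frac_power a b u \<longleftrightarrow> (\<exists>v. v \<noteq> [] \<and> b dvd length v \<and> u = frac_power a b v)"

definition power_free :: "nat \<Rightarrow> nat \<Rightarrow> 'a list \<Rightarrow> bool" where
  "power_free a b w \<longleftrightarrow> (\<forall>u. sublist u w \<longrightarrow> \<not> is_frac_power a b u)"

definition morph :: "('a \<Rightarrow> 'b list) \<Rightarrow> 'a list \<Rightarrow> 'b list" where
  "morph \<phi> w = concat (map \<phi> w)"

definition uniform_morphism :: "nat \<Rightarrow> ('a \<Rightarrow> 'b list) \<Rightarrow> bool" where
  "uniform_morphism k \<phi> \<longleftrightarrow> (\<forall>n. length (\<phi> n) = k)"

definition power_free_morphism :: "nat \<Rightarrow> nat \<Rightarrow> ('a \<Rightarrow> 'a list) \<Rightarrow> bool" where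
  "power_free_morphism a b \<phi> \<longleftrightarrow> (\<forall>w. power_free a b w \<longrightarrow> power_free a b (morph \<phi> w))"

definition occurs_at :: "'a list \<Rightarrow> 'a list \<Rightarrow> nat \<Rightarrow> bool" where
  "occurs_at x u i \<longleftrightarrow> i + length x \<le> length u \<and> take (length x) (drop i u) = x"

definition locates_words :: "nat \<Rightarrow> ('a \<Rightarrow> 'a list) \<Rightarrow> nat \<Rightarrow> bool" where
  "locates_words k \<phi> l \<longleftrightarrow>
     (\<forall>x. length x = l \<longrightarrow>
        (\<exists>j::int. \<forall>w i. occurs_at x (morph \<phi> w) i \<longrightarrow> [int i = j] (mod int k)))"

text \<open>
  The subtractions are on \<^typ>\<open>nat\<close>; no truncation takes place for \<open>6/5 < a/b < 5/4\<close>,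
  as the lemma below shows.
\<close>
definition phi :: "nat \<Rightarrow> nat \<Rightarrow> nat \<Rightarrow> nat list" where
  "phi a b n =
     replicate (6 * a - 7 * b - 1) 0 @ [1] @
     replicate (4 * b - 3 * a - 1) 0 @ [1] @
     replicate (10 * b - 8 * a - 1) 0 @ [1] @
     replicate (6 * a - 7 * b - 1) 0 @ [n + 1]"

lemma phi_exponents:
  assumes "0 < b" and "6 / 5 < real a / real b" and "real a / real b < 5 / 4"
  shows "int (6 * a - 7 * b - 1) = 6 * int a - 7 * int b - 1"
    and "int (4 * b - 3 * a - 1) = - 3 * int a + 4 * int b - 1"
    and "int (10 * b - 8 * a - 1) = - 8 * int a + 10 * int b - 1"
proof -
  have "6 * real b < 5 * real a" "4 * real a < 5 * real b"
    using assms by (simp_all add: field_simps)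
  then have "6 * b < 5 * a" "4 * a < 5 * b" by linarith+
  then show "int (6 * a - 7 * b - 1) = 6 * int a - 7 * int b - 1"
    and "int (4 * b - 3 * a - 1) = - 3 * int a + 4 * int b - 1"
    and "int (10 * b - 8 * a - 1) = - 8 * int a + 10 * int b - 1"
    by linarith+
qed

end

theory Submission
  imports Defs
begin

text \<open>
  Put \<open>D = a - b\<close>. The nonzero letters of \<open>\<phi>(w)\<close> occur periodically modulo \<open>a\<close>, with gaps
  \<open>P, Q, R, P\<close> where \<open>P = 6a - 7b\<close>, \<open>Q = 4b - 3a\<close>, \<open>R = 10b - 8a\<close> are pairwise distinct; this
  determines positions modulo \<open>a\<close>. An \<open>a/b\<close>-power in \<open>\<phi>(w)\<close> amounts to a factor of length \<open>mD\<close> that occurs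
  again at distance \<open>mb\<close>. If \<open>m \<ge> 6\<close> then \<open>mD \<ge> a\<close>, so \<open>a\<close> divides \<open>mb\<close>, hence \<open>m\<close>, and reading off
  the last letters of the images gives an \<open>a/b\<close>-power in \<open>w\<close>. If \<open>m \<le> 5\<close> then \<open>mb\<close> is congruent to
  \<open>-mD\<close> modulo \<open>a\<close>, so the periodic pattern of nonzero letters would contain a square of period
  \<open>mD < a\<close>, and comparing gaps excludes this.
\<close>

section \<open>Fractional powers and uniform morphisms\<close>

lemma frac_power_between_1_2:
  assumes "b \<le> a" "a < 2 * b" "length v = b * m"
  shows "frac_power a b v = v @ take (m * (a - b)) v"
proof -
  have 1: "a div b = 1" using assms by (intro div_nat_eqI) auto
  have 2: "a mod b = a - b" using assms 1 by (simp add: mod_if)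
  have "length v * (a mod b) div b = m * (a - b)"
    using assms unfolding 2 by (simp add: mult.assoc)
  then show ?thesis unfolding frac_power_def by (simp add: 1)
qed

text \<open>Here \<open>m\<close> is \<open>length v div b\<close>. As \<open>a < 2 * b\<close>, the
  repeated part is a proper prefix of \<open>v\<close>, so a power is a factor of length
  \<open>m * (a - b)\<close> recurring at distance \<open>b * m\<close>, with total length
  \<open>a * m\<close>.\<close>

lemma power_free_iff:
  assumes "b \<le> a" "a < 2 * b"
  shows "power_free a b w \<longleftrightarrow>
    (\<nexists>s m. 0 < m \<and> s + a * m \<le> length w \<and> (\<forall>i < m * (a - b). w ! (s + i) = w ! (s + b * m + i)))"
    (is "_ \<longleftrightarrow> (\<nexists>s m. ?P s m)")
proof -
  have b: "0 < b" using assms by auto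
  have len: "b * m + m * (a - b) = a * m" for m
    using assms(1) by (simp add: algebra_simps diff_mult_distrib2)
  have le: "m * (a - b) \<le> b * m" for m
    using assms(2) by (metis le_diff_conv less_imp_le_nat mult.commute mult_2 mult_le_mono1)
  have "?P s m" if "w = ps @ (v @ take (m * (a - b)) v) @ ss" "v \<noteq> []" "length v = b * m"
      "s = length ps" for ps v ss s m
  proof (intro conjI allI impI)
    show "0 < m" using that(2,3) by (cases m) auto
    show "s + a * m \<le> length w"
      using that len[of m] by (simp add: min.absorb2[OF le])
  next
    fix i assume i: "i < m * (a - b)"
    then have "i < b * m" using le[of m] by linarith
    then show "w ! (s + i) = w ! (s + b * m + i)"
      using that(1,3,4) i by (simp add: nth_append min.absorb2[OF le] del: mult_less_cancel2)
  qed
  moreover have "\<exists>ps v ss. w = ps @ (v @ take (m * (a - b)) v) @ ss \<and> v \<noteq> [] \<and> length v = b * m"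
    if "?P s m" for s m
  proof -
    define v where "v = take (b * m) (drop s w)"
    have lw: "s + b * m + m * (a - b) \<le> length w" using that len[of m] by simp
    then have lv: "length v = b * m" by (simp add: v_def)
    have "take (a * m) (drop s w) = v @ take (m * (a - b)) (drop (s + b * m) w)"
      by (simp add: v_def take_add add.commute flip: len)
    moreover have "take (m * (a - b)) (drop (s + b * m) w) = take (m * (a - b)) v"
      using that lw lv le[of m] by (intro nth_equalityI)
        (simp_all add: v_def min.absorb1 min.absorb2[OF le] add.assoc[symmetric] del: mult_less_cancel2)
    ultimately have "w = take s w @ (v @ take (m * (a - b)) v) @ drop (a * m) (drop s w)"
      by (metis append_take_drop_id)
    moreover have "v \<noteq> []" using lv that b by auto
    ultimately show ?thesis using lv by blast
  qed
  moreover have "power_free a b w \<longleftrightarrow>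
    (\<nexists>m ps v ss. w = ps @ (v @ take (m * (a - b)) v) @ ss \<and> v \<noteq> [] \<and> length v = b * m)"
    unfolding power_free_def is_frac_power_def sublist_def dvd_def
    using frac_power_between_1_2[OF assms] by metis
  ultimately show ?thesis by metis
qed

lemma length_morph:
  assumes "uniform_morphism k \<phi>"
  shows "length (morph \<phi> w) = k * length w"
  using assms by (induction w) (simp_all add: morph_def uniform_morphism_def)

lemma nth_morph:
  assumes "uniform_morphism k \<phi>" "j < length w" "r < k"
  shows "morph \<phi> w ! (k * j + r) = \<phi> (w ! j) ! r"
  using assms(2)
proof (induction w arbitrary: j)
  case (Cons x w)
  have "length (\<phi> x) = k" using assms(1) by (simp add: uniform_morphism_def)
  with Cons assms(3) show ?case
    by (cases j) (auto simp: morph_def nth_append)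
qed simp

section \<open>The pattern of nonzero letters\<close>

text \<open>With \<open>D = a - b\<close> the inequalities say \<open>5D < a < 6D\<close>, which
  separates \<open>m \<le> 5\<close> from \<open>m \<ge> 6\<close>; they also make \<open>P\<close>,
  \<open>Q\<close>, \<open>R\<close> positive. \<open>P = Q\<close> iff \<open>9a = 11b\<close>,
  \<open>P = R\<close> iff \<open>14a = 17b\<close>, and \<open>Q = R\<close> would need
  \<open>5a = 6b\<close>.\<close>

locale power_range =
  fixes a b :: nat
  assumes lower: "6 * b < 5 * a" and upper: "4 * a < 5 * b"
    and not_11_9: "9 * a \<noteq> 11 * b" and not_17_14: "14 * a \<noteq> 17 * b"
begin

text \<open>The letter at position \<open>i\<close> of \<open>\<phi>(w)\<close> is nonzero iff \<open>i + 1\<close> is marked.\<close>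
definition marked :: "int \<Rightarrow> bool" where
  "marked x \<longleftrightarrow> x mod int a \<in> {0, 6 * int a - 7 * int b, 3 * int a - 3 * int b, 7 * int b - 5 * int a}"

lemma bounds_int: "6 * int b < 5 * int a" "4 * int a < 5 * int b"
    "9 * int a \<noteq> 11 * int b" "14 * int a \<noteq> 17 * int b" "0 < int a"
  using lower upper not_11_9 not_17_14 by linarith+

lemma marked_cong: "x mod int a = y mod int a \<Longrightarrow> marked x = marked y"
  by (simp add: marked_def)

lemma marked_add_self [simp]: "marked (x + int a) = marked x"
  by (simp add: marked_def)

text \<open>The listed values are the partial sums of the gaps \<open>P, Q, R, P\<close>, over two
  periods. Two periods suffice to replace \<open>mod\<close> by linear arithmetic, since a sum of
  two residues stays below \<open>2a\<close>.\<close>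

lemma marked_iff:
  assumes "0 \<le> x" "x < 2 * int a"
  shows "marked x \<longleftrightarrow>
    x \<in> {0, 6 * int a - 7 * int b, 3 * int a - 3 * int b, 7 * int b - 5 * int a,
         int a, 7 * int a - 7 * int b, 4 * int a - 3 * int b, 7 * int b - 4 * int a}"
proof (cases "x < int a")
  case True
  then have "x mod int a = x" using assms by simp
  with True bounds_int show ?thesis unfolding marked_def by auto
next
  case False
  then have "x mod int a = x - int a"
    using assms by (metis diff_ge_0_iff_ge diff_less_eq linorder_not_less minus_mod_self2
        mod_pos_pos_trivial mult_2)
  with False assms bounds_int show ?thesis unfolding marked_def by auto
qed

text \<open>The gaps read from a mark are one of the four rotations of \<open>P, Q, R, P\<close>,
  chosen by the residue of \<open>p\<close>. The gap \<open>g4\<close> leads from the last mark to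
  \<open>p + a\<close>, hence is absent from the second property.\<close>

lemma marked_gaps:
  assumes "marked p"
  obtains g1 g2 g3 g4 where
    "(g1, g2, g3, g4) \<in>
      (let P = 6 * int a - 7 * int b; Q = 4 * int b - 3 * int a; R = 10 * int b - 8 * int a
       in {(P, Q, R, P), (Q, R, P, P), (R, P, P, Q), (P, P, Q, R)})"
    "\<And>y. 0 \<le> y \<Longrightarrow> y < int a \<Longrightarrow> marked (p + y) \<longleftrightarrow> y \<in> {0, g1, g1 + g2, g1 + g2 + g3}"
proof -
  define c where "c = p mod int a"
  have shift: "marked (p + y) \<longleftrightarrow> marked (c + y)" for y
    by (rule marked_cong) (simp add: c_def mod_simps)
  have c: "c = 0 \<or> c = 6 * int a - 7 * int b \<or> c = 3 * int a - 3 * int b \<or> c = 7 * int b - 5 * int a"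
    using assms by (auto simp: marked_def c_def)
  have iff: "marked (p + y) \<longleftrightarrow>
    c + y \<in> {0, 6 * int a - 7 * int b, 3 * int a - 3 * int b, 7 * int b - 5 * int a,
         int a, 7 * int a - 7 * int b, 4 * int a - 3 * int b, 7 * int b - 4 * int a}"
    if "0 \<le> y" "y < int a" for y
    unfolding shift using that c bounds_int by (intro marked_iff) auto
  note b = bounds_int(1,2,5)
  from c show ?thesis
  proof (elim disjE)
    assume "c = 0"
    show ?thesis
    proof (rule that[of "6 * int a - 7 * int b" "4 * int b - 3 * int a" "10 * int b - 8 * int a"
          "6 * int a - 7 * int b"])
      fix y assume y: "0 \<le> y" "y < int a"
      show "marked (p + y) \<longleftrightarrow> y \<in> {0, 6 * int a - 7 * int b,
        6 * int a - 7 * int b + (4 * int b - 3 * int a),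
        6 * int a - 7 * int b + (4 * int b - 3 * int a) + (10 * int b - 8 * int a)}"
        unfolding iff[OF y] insert_iff empty_iff using y b \<open>c = 0\<close> by (smt (verit))
    qed (simp add: Let_def)
  next
    assume "c = 6 * int a - 7 * int b"
    show ?thesis
    proof (rule that[of "4 * int b - 3 * int a" "10 * int b - 8 * int a" "6 * int a - 7 * int b"
          "6 * int a - 7 * int b"])
      fix y assume y: "0 \<le> y" "y < int a"
      show "marked (p + y) \<longleftrightarrow> y \<in> {0, 4 * int b - 3 * int a,
        4 * int b - 3 * int a + (10 * int b - 8 * int a),
        4 * int b - 3 * int a + (10 * int b - 8 * int a) + (6 * int a - 7 * int b)}"
        unfolding iff[OF y] insert_iff empty_iff using y b \<open>c = 6 * int a - 7 * int b\<close> by (smt (verit))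
    qed (simp add: Let_def)
  next
    assume "c = 3 * int a - 3 * int b"
    show ?thesis
    proof (rule that[of "10 * int b - 8 * int a" "6 * int a - 7 * int b" "6 * int a - 7 * int b"
          "4 * int b - 3 * int a"])
      fix y assume y: "0 \<le> y" "y < int a"
      show "marked (p + y) \<longleftrightarrow> y \<in> {0, 10 * int b - 8 * int a,
        10 * int b - 8 * int a + (6 * int a - 7 * int b),
        10 * int b - 8 * int a + (6 * int a - 7 * int b) + (6 * int a - 7 * int b)}"
        unfolding iff[OF y] insert_iff empty_iff using y b \<open>c = 3 * int a - 3 * int b\<close> by (smt (verit))
    qed (simp add: Let_def)
  next
    assume "c = 7 * int b - 5 * int a"
    show ?thesis
    proof (rule that[of "6 * int a - 7 * int b" "6 * int a - 7 * int b" "4 * int b - 3 * int a"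
          "10 * int b - 8 * int a"])
      fix y assume y: "0 \<le> y" "y < int a"
      show "marked (p + y) \<longleftrightarrow> y \<in> {0, 6 * int a - 7 * int b,
        6 * int a - 7 * int b + (6 * int a - 7 * int b),
        6 * int a - 7 * int b + (6 * int a - 7 * int b) + (4 * int b - 3 * int a)}"
        unfolding iff[OF y] insert_iff empty_iff using y b \<open>c = 7 * int b - 5 * int a\<close> by (smt (verit))
    qed (simp add: Let_def)
  qed
qed

text \<open>Each of \<open>P\<close>, \<open>Q\<close>, \<open>R\<close> is less than
  \<open>2D\<close>: for \<open>P\<close> this is \<open>4a < 5b\<close>, for \<open>Q\<close> and
  \<open>R\<close> it is \<open>6b < 5a\<close>.\<close>

lemma marked_within:
  obtains y where "0 \<le> y" "y < 2 * (int a - int b)" "marked (t + y)"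
proof -
  define c where "c = t mod int a"
  have shift: "marked (t + y) \<longleftrightarrow> marked (c + y)" for y
    by (rule marked_cong) (simp add: c_def mod_simps)
  have c: "0 \<le> c" "c < int a" using bounds_int by (auto simp: c_def)
  \<comment> \<open>\<open>n\<close> is the first mark at or after \<open>c\<close>; past the last
    mark of the period it is \<open>a\<close>, the first mark of the next one.\<close>
  define n where "n = (if c = 0 then 0 else if c \<le> 6 * int a - 7 * int b then 6 * int a - 7 * int b
    else if c \<le> 3 * int a - 3 * int b then 3 * int a - 3 * int b
    else if c \<le> 7 * int b - 5 * int a then 7 * int b - 5 * int a else int a)"
  have "0 \<le> n - c" "n - c < 2 * (int a - int b)" "0 \<le> n" "n < 2 * int a"
    using c bounds_int by (auto simp: n_def)
  moreover have "marked n" using \<open>0 \<le> n\<close> \<open>n < 2 * int a\<close>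
    by (subst marked_iff) (auto simp: n_def)
  ultimately show ?thesis using that[of "n - c"] shift by auto
qed

text \<open>The gaps after the first mark \<open>p\<close> of the first half must recur after
  \<open>p + L\<close>. As \<open>L < a\<close>, it is a sum of one, two or three consecutive gaps.
  One gap is never a multiple of \<open>D\<close>; two force \<open>g1 = g3\<close>; three force
  \<open>g1 = g4\<close> and \<open>g1 = g2\<close>. Distinctness of \<open>P\<close>,
  \<open>Q\<close>, \<open>R\<close> excludes both.\<close>

lemma marked_no_square:
  fixes m t :: int
  assumes m: "1 \<le> m" "m \<le> 5" and L: "L = m * (int a - int b)"
    and square: "\<And>x. t \<le> x \<Longrightarrow> x < t + L \<Longrightarrow> marked (x + L) = marked x"
  shows False
proof -
  note b = bounds_int
  have D: "0 < int a - int b" using b by linarith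
  have m_cases: "m = 1 \<or> m = 2 \<or> m = 3 \<or> m = 4 \<or> m = 5" using m by linarith
  have L_pos: "0 < L" and L_less: "L < int a" and L_ge: "int a - int b \<le> L"
    using m_cases b by (auto simp: L)
  obtain y where y: "0 \<le> y" "y < 2 * (int a - int b)" "marked (t + y)" by (rule marked_within)
  \<comment> \<open>The window of length \<open>2D\<close> can exceed \<open>L\<close> if
    \<open>m = 1\<close>; a mark found in the second half is then moved back by
    \<open>L\<close>.\<close>
  have "\<exists>z. 0 \<le> z \<and> z < L \<and> marked (t + z)"
  proof (cases "y < L")
    case False
    then have "marked (t + (y - L))" using square[of "t + (y - L)"] y L_ge by (simp add: algebra_simps)
    then show ?thesis using False y L_ge by (intro exI[of _ "y - L"]) auto
  qed (use y in auto)
  then have ex: "\<exists>n. int n < L \<and> marked (t + int n)" by (metis zero_le_imp_eq_int)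
  define k where "k = (LEAST n. int n < L \<and> marked (t + int n))"
  have k: "int k < L" "marked (t + int k)" using LeastI_ex[OF ex] by (auto simp: k_def)
  define p where "p = t + int k"
  have first: "\<not> marked x" if "t \<le> x" "x < p" for x
  proof -
    have "nat (x - t) < k" using that by (simp add: p_def)
    from not_less_Least[OF this[unfolded k_def]] show ?thesis
      using that k(1) by (auto simp: p_def)
  qed
  have p: "marked p" "t \<le> p" "p < t + L" using k by (auto simp: p_def)
  obtain g1 g2 g3 g4 where g: "(g1, g2, g3, g4) \<in>
      (let P = 6 * int a - 7 * int b; Q = 4 * int b - 3 * int a; R = 10 * int b - 8 * int a
       in {(P, Q, R, P), (Q, R, P, P), (R, P, P, Q), (P, P, Q, R)})"
    and iff0: "\<And>y. 0 \<le> y \<Longrightarrow> y < int a \<Longrightarrow> marked (p + y) \<longleftrightarrow> y \<in> {0, g1, g1 + g2, g1 + g2 + g3}"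
    using marked_gaps[OF p(1)] by metis
  \<comment> \<open>\<open>L \<noteq> g1\<close> holds because \<open>P\<close> and \<open>Q\<close>
    lie strictly between \<open>D\<close> and \<open>2D\<close>, while \<open>0 < R < 2D\<close> and
    \<open>R = D\<close> iff \<open>9a = 11b\<close>.\<close>
  have pos: "0 < g1" "0 < g2" "0 < g3" "0 < g4" and sum: "g1 + g2 + g3 + g4 = int a"
    and distinct3: "g1 \<noteq> g3" "\<not> (g1 = g2 \<and> g1 = g4)"
    and L_neq: "L \<noteq> g1"
    using g b m_cases by (auto simp: Let_def L)
  have iff1: "marked (p + y) \<longleftrightarrow> y \<in> {int a, int a + g1, int a + g1 + g2, int a + g1 + g2 + g3}"
    if "int a \<le> y" "y < 2 * int a" for y
    using iff0[of "y - int a"] that marked_add_self[of "p + (y - int a)"] by auto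
  have shift: "marked (p + (y + L)) = marked (p + y)" if "t \<le> p + y" "p + y < t + L" for y
    using square[OF that] by (simp add: add.assoc)
  \<comment> \<open>A mark less than \<open>L\<close> beyond \<open>p\<close> that fell in the
    second half would have a copy in \<open>[t, p)\<close>, against the choice of
    \<open>p\<close>.\<close>
  have inside: "p + y < t + L" if "0 \<le> y" "y < L" "marked (p + y)" for y
  proof (rule ccontr)
    assume "\<not> p + y < t + L"
    then have "marked (p + (y - L))" using shift[of "y - L"] that p by auto
    then show False using first[of "p + (y - L)"] that \<open>\<not> p + y < t + L\<close> by auto
  qed
  have "marked (p + L)" using shift[of 0] p by simp
  then have "L = g1 + g2 \<or> L = g1 + g2 + g3" using iff0[of L] L_pos L_less L_neq by auto
  then show False
  proof
    assume L2: "L = g1 + g2"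
    have in1: "p + g1 < t + L" using inside[of g1] iff0[of g1] pos sum L2 by auto
    \<comment> \<open>The gap after \<open>p + L\<close> is \<open>g3\<close> and must copy
      \<open>g1\<close>: a shorter one would put a mark inside the gap \<open>g1\<close>, a longer
      one would leave \<open>p + g1 + L\<close> unmarked.\<close>
    have "\<not> g3 < g1"
    proof
      assume "g3 < g1"
      then have "marked (p + g3)"
        using shift[of g3] in1 p pos iff0[of "g3 + L"] sum L2 by auto
      then show False using iff0[of g3] \<open>g3 < g1\<close> pos sum by auto
    qed
    moreover have "marked (p + (g1 + L))" using shift[of g1] in1 p pos iff0[of g1] sum by auto
    ultimately show False
      using iff0[of "g1 + L"] pos sum L2 distinct3 by auto
  next
    assume L3: "L = g1 + g2 + g3"
    have in1: "p + g1 < t + L" using inside[of g1] iff0[of g1] pos sum L3 by auto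
    have in2: "p + (g1 + g2) < t + L" using inside[of "g1 + g2"] iff0[of "g1 + g2"] pos sum L3 by auto
    have "\<not> g4 < g1"
    proof
      assume "g4 < g1"
      then have "marked (p + g4)"
        using shift[of g4] in1 p pos iff1[of "g4 + L"] sum L3 by auto
      then show False using iff0[of g4] \<open>g4 < g1\<close> pos sum by auto
    qed
    moreover have "marked (p + (g1 + L))" using shift[of g1] in1 p pos iff0[of g1] sum by auto
    ultimately have eq14: "g1 = g4"
      using iff0[of "g1 + L"] iff1[of "g1 + L"] pos sum L3 by (smt (verit) insert_iff empty_iff)
    \<comment> \<open>The gap after \<open>p + g1\<close> is \<open>g2\<close>. Its copy follows
      \<open>p + L + g4 = p + a\<close>, where the pattern restarts with \<open>g1\<close>.\<close>
    have "\<not> g1 < g2"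
    proof
      assume "g1 < g2"
      then have "marked (p + (g1 + g1))"
        using shift[of "g1 + g1"] in2 p pos iff1[of "g1 + g1 + L"] sum L3 eq14 by auto
      then show False using iff0[of "g1 + g1"] \<open>g1 < g2\<close> pos sum by auto
    qed
    moreover have "marked (p + (g1 + g2 + L))"
      using shift[of "g1 + g2"] in2 p pos iff0[of "g1 + g2"] sum by auto
    ultimately have "g1 = g2"
      using iff1[of "g1 + g2 + L"] pos sum L3 eq14 by (smt (verit) insert_iff empty_iff)
    with eq14 distinct3 show False by simp
  qed
qed

text \<open>By periodicity, shifting by \<open>c = t - s\<close> modulo \<open>a\<close> preserves
  all marks. So \<open>c\<close> and its sums with the other marks are marks, and as
  \<open>P\<close>, \<open>Q\<close>, \<open>R\<close> are distinct, no nontrivial rotation does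
  this.\<close>

lemma marked_period:
  assumes "\<And>y. 0 \<le> y \<Longrightarrow> y < int a \<Longrightarrow> marked (s + y) = marked (t + y)"
  shows "s mod int a = t mod int a"
proof -
  note b = bounds_int
  have all: "marked (s + y) = marked (t + y)" for y
  proof -
    have "marked (x + y) = marked (x + y mod int a)" for x
      by (rule marked_cong) (simp add: mod_simps)
    then show ?thesis using assms[of "y mod int a"] b by simp
  qed
  define c where "c = (t - s) mod int a"
  have "marked y = marked (c + y)" for y
  proof -
    have "marked (t + (y - s)) = marked (c + y)"
      by (rule marked_cong) (simp add: c_def mod_simps algebra_simps)
    then show ?thesis using all[of "y - s"] by simp
  qed
  note eq = this
  have c: "0 \<le> c" "c < int a" using b by (auto simp: c_def)
  have "marked 0" by (simp add: marked_def)
  then have "marked c" using eq[of 0] by simp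
  then have c_cases: "c = 0 \<or> c = 6 * int a - 7 * int b \<or> c = 3 * int a - 3 * int b
      \<or> c = 7 * int b - 5 * int a"
    using c b by (auto simp: marked_iff)
  have P: "marked (c + (6 * int a - 7 * int b))"
    unfolding eq[symmetric] using b by (subst marked_iff) auto
  have PQ: "marked (c + (3 * int a - 3 * int b))"
    unfolding eq[symmetric] using b by (subst marked_iff) auto
  have PQR: "marked (c + (7 * int b - 5 * int a))"
    unfolding eq[symmetric] using b by (subst marked_iff) auto
  have "c = 0"
    using c_cases
  proof (elim disjE)
    assume "c = 6 * int a - 7 * int b"
    with P PQ PQR b show ?thesis by (auto simp: marked_iff)
  next
    assume "c = 3 * int a - 3 * int b"
    with P PQ PQR b show ?thesis by (auto simp: marked_iff)
  next
    assume "c = 7 * int b - 5 * int a"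
    with P PQ PQR b show ?thesis by (auto simp: marked_iff)
  qed
  then show ?thesis unfolding c_def by (metis mod_0_imp_dvd mod_eq_dvd_iff)
qed

section \<open>The morphism\<close>

lemma uniform_phi: "uniform_morphism a (phi a b)"
  using lower upper by (auto simp: uniform_morphism_def phi_def)

lemma phi_last: "phi a b n ! (a - 1) = n + 1"
proof -
  have "length (phi a b n) = a" using uniform_phi by (simp add: uniform_morphism_def)
  moreover have "last (phi a b n) = n + 1" "phi a b n \<noteq> []" by (simp_all add: phi_def)
  ultimately show ?thesis by (simp add: last_conv_nth)
qed

text \<open>The final letter \<open>n + 1\<close> is nonzero for every \<open>n\<close>, so the
  pattern of zeros does not depend on \<open>n\<close>.\<close>

lemma phi_nonzero_iff:
  assumes "j < a"
  shows "phi a b n ! j \<noteq> 0 \<longleftrightarrow> marked (int j + 1)"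
proof -
  have "phi a b n ! j \<noteq> 0 \<longleftrightarrow>
      j + 1 = 6 * a - 7 * b \<or> j + 1 = 3 * a - 3 * b \<or> j + 1 = 7 * b - 5 * a \<or> j + 1 = a"
  proof -
    \<comment> \<open>Naming the lengths of the zero runs removes truncated subtraction; the cases
      below follow the four blocks of the image.\<close>
    define p q r where "p = 6 * a - 7 * b - 1" and "q = 4 * b - 3 * a - 1" and "r = 10 * b - 8 * a - 1"
    have phi: "phi a b n =
        replicate p 0 @ [1] @ replicate q 0 @ [1] @ replicate r 0 @ [1] @ replicate p 0 @ [n + 1]"
      by (simp add: phi_def p_def q_def r_def)
    have eqs: "6 * a - 7 * b = p + 1" "3 * a - 3 * b = p + q + 2" "7 * b - 5 * a = p + q + r + 3"
        "a = 2 * p + q + r + 4"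
      using lower upper by (simp_all add: p_def q_def r_def)
    have "j < 2 * p + q + r + 4" using assms eqs by simp
    show ?thesis
    proof (cases "j \<le> p")
      case True
      then show ?thesis unfolding phi eqs(1-3) using eqs(4) by (auto simp: nth_append)
    next
      case False
      then obtain k where k: "j = Suc p + k" by (metis le_Suc_ex not_less_eq_eq)
      show ?thesis
      proof (cases "k \<le> q")
        case True
        then show ?thesis unfolding phi eqs(1-3) using eqs(4) by (auto simp: k nth_append)
      next
        case False
        then obtain l where l: "k = Suc q + l" by (metis le_Suc_ex not_less_eq_eq)
        show ?thesis
        proof (cases "l \<le> r")
          case True
          then show ?thesis unfolding phi eqs(1-3) using eqs(4) by (auto simp: k l nth_append)
        next
          case False
          then obtain i where i: "l = Suc r + i" by (metis le_Suc_ex not_less_eq_eq)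
          show ?thesis
            unfolding phi eqs(1-3) using eqs(4) \<open>j < 2 * p + q + r + 4\<close>
            by (auto simp: k l i nth_append)
        qed
      qed
    qed
  qed
  also have "\<dots> \<longleftrightarrow> marked (int j + 1)"
    using assms lower upper by (subst marked_iff) auto
  finally show ?thesis .
qed

lemma morph_nonzero_iff:
  assumes "i < a * length w"
  shows "morph (phi a b) w ! i \<noteq> 0 \<longleftrightarrow> marked (int i + 1)"
proof -
  have a: "0 < a" using lower by simp
  have "i div a < length w" using assms a by (simp add: less_mult_imp_div_less mult.commute)
  then have "morph (phi a b) w ! i = phi a b (w ! (i div a)) ! (i mod a)"
    using nth_morph[OF uniform_phi, of "i div a" w "i mod a"] a by simp
  moreover have "marked (int (i mod a) + 1) = marked (int i + 1)"
    by (rule marked_cong) (simp add: zmod_int mod_simps)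
  ultimately show ?thesis using phi_nonzero_iff[of "i mod a"] a by simp
qed

lemma morph_last:
  assumes "j < length w"
  shows "morph (phi a b) w ! (a * j + (a - 1)) = w ! j + 1"
proof -
  have "a - 1 < a" using lower by simp
  from nth_morph[OF uniform_phi assms this] show ?thesis by (simp only: phi_last)
qed

text \<open>Equal letters give equal patterns of marks over a full period. Two words are allowed
  because the residue in \<open>locates_words\<close> must serve all \<open>w\<close> at
  once.\<close>

lemma equal_factors_cong:
  assumes "i + a \<le> a * length w" "i' + a \<le> a * length w'"
    and "\<And>l. l < a \<Longrightarrow> morph (phi a b) w ! (i + l) = morph (phi a b) w' ! (i' + l)"
  shows "[int i = int i'] (mod int a)"
proof -
  have "marked (int i + 1 + y) = marked (int i' + 1 + y)" if y: "0 \<le> y" "y < int a" for y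
  proof -
    obtain l where l: "y = int l" "l < a" using y by (metis nonneg_int_cases of_nat_less_iff)
    show ?thesis
      using morph_nonzero_iff[of "i + l" w] morph_nonzero_iff[of "i' + l" w'] assms l
      by (simp add: ac_simps)
  qed
  then have "(int i + 1) mod int a = (int i' + 1) mod int a" by (rule marked_period)
  then show ?thesis by (simp add: cong_def mod_eq_dvd_iff)
qed

section \<open>Locating words of length \<open>a\<close>\<close>

lemma locates_phi: "locates_words a (phi a b) a"
  unfolding locates_words_def
proof (intro allI impI)
  fix x :: "nat list" assume len: "length x = a"
  show "\<exists>j. \<forall>w i. occurs_at x (morph (phi a b) w) i \<longrightarrow> [int i = j] (mod int a)"
  \<comment> \<open>Any one occurrence supplies the residue; if there is none, every
    \<open>j\<close> works vacuously.\<close>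
  proof (cases "\<exists>w i. occurs_at x (morph (phi a b) w) i")
    case True
    then obtain w' i' where occ': "occurs_at x (morph (phi a b) w') i'" by blast
    have occ_nth: "i + a \<le> a * length w \<and> (\<forall>l<a. morph (phi a b) w ! (i + l) = x ! l)"
      if "occurs_at x (morph (phi a b) w) i" for w i
    proof -
      have le: "i + a \<le> a * length w" and tk: "take a (drop i (morph (phi a b) w)) = x"
        using that by (auto simp: occurs_at_def len length_morph[OF uniform_phi])
      have "morph (phi a b) w ! (i + l) = x ! l" if "l < a" for l
        unfolding tk[symmetric] using that le by (simp add: length_morph[OF uniform_phi])
      with le show ?thesis by simp
    qed
    have "[int i = int i'] (mod int a)" if "occurs_at x (morph (phi a b) w) i" for w i
      using occ_nth[OF that] occ_nth[OF occ'] by (intro equal_factors_cong[of i w i' w']) auto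
    then show ?thesis by blast
  qed blast
qed

section \<open>Power-freeness of the morphism\<close>

lemma power_free_phi:
  assumes "coprime a b"
  shows "power_free_morphism a b (phi a b)"
  unfolding power_free_morphism_def
proof (intro allI impI)
  fix w :: "nat list" assume free: "power_free a b w"
  have ab: "b \<le> a" "a < 2 * b" "0 < a" using lower upper by auto
  let ?u = "morph (phi a b) w"
  show "power_free a b ?u"
    unfolding power_free_iff[OF ab(1,2)]
  proof (rule notI, elim exE conjE)
    fix s m assume m: "0 < m" and le: "s + a * m \<le> length ?u"
      and eq: "\<forall>i < m * (a - b). ?u ! (s + i) = ?u ! (s + b * m + i)"
    have len: "b * m + m * (a - b) = a * m"
      using ab by (simp add: algebra_simps diff_mult_distrib2)
    have le': "s + b * m + m * (a - b) \<le> a * length w"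
      using le len by (simp add: length_morph[OF uniform_phi])
    show False
    proof (cases "m \<le> 5")
      case True
      define L where "L = int m * (int a - int b)"
      have intL: "int (m * (a - b)) = L" using ab by (simp add: L_def of_nat_diff)
      \<comment> \<open>Since \<open>b * m = a * m - L\<close>, the recurrence at distance
        \<open>b * m\<close> acts on marks as a shift by \<open>-L\<close>. The square therefore
        starts \<open>L\<close> before \<open>s + 1\<close>, the mark belonging to position
        \<open>s\<close>.\<close>
      have "marked (x + L) = marked x"
        if x: "int s + 1 - L \<le> x" "x < int s + 1 - L + L" for x
      proof -
        obtain i where i: "x + L = int s + 1 + int i" "i < m * (a - b)"
        proof (rule that)
          show "x + L = int s + 1 + int (nat (x + L - int s - 1))" using x by simp
          show "nat (x + L - int s - 1) < m * (a - b)" using x intL by linarith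
        qed
        have "marked (int (s + i) + 1) = marked (int (s + b * m + i) + 1)"
          using morph_nonzero_iff[of "s + i" w] morph_nonzero_iff[of "s + b * m + i" w] i(2) eq le'
          by simp
        moreover have "marked (int (s + b * m + i) + 1) = marked x"
        proof (rule marked_cong)
          have "int (s + b * m + i) + 1 = x + int m * int a"
            using i(1) by (simp add: L_def algebra_simps)
          then show "(int (s + b * m + i) + 1) mod int a = x mod int a" by simp
        qed
        moreover have "x + L = int (s + i) + 1" using i(1) by simp
        ultimately show ?thesis by simp
      qed
      then show False
        using marked_no_square[of "int m" L "int s + 1 - L"] m True L_def by auto
    next
      case False
      then have "6 * (a - b) \<le> m * (a - b)" by (intro mult_le_mono1) auto
      then have long: "a \<le> m * (a - b)" using lower by linarith
      have "[int s = int (s + b * m)] (mod int a)"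
        using le' long eq by (intro equal_factors_cong[of s w _ w]) auto
      then have "int a dvd int (b * m)"
        by (simp add: cong_iff_dvd_diff dvd_minus_iff flip: of_nat_mult)
      then have "a dvd m" using assms by (metis coprime_dvd_mult_right_iff of_nat_dvd_iff)
      then obtain k where k: "m = a * k" by blast
      define j where "j = s div a"
      have s: "a * j \<le> s" "s < a * j + a"
        using mult_div_mod_eq[of a s] mod_less_divisor[OF ab(3), of s] unfolding j_def by linarith+
      have "a * (j + a * k) \<le> a * length w"
        using le s by (simp add: k length_morph[OF uniform_phi] algebra_simps)
      then have in_w: "j + a * k \<le> length w" using ab(3) by simp
      have "w ! (j + i) = w ! (j + b * k + i)" if i: "i < k * (a - b)" for i
      proof -
        have "k * (a - b) + b * k = a * k"
          using ab by (simp add: algebra_simps diff_mult_distrib2)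
        then have ik: "j + b * k + i < length w" using i in_w by linarith
        \<comment> \<open>\<open>e\<close> is the offset from \<open>s\<close> to the last letter of
          the image of \<open>w ! (j + i)\<close>. It stays below \<open>a * (i + 1)\<close>, hence
          inside the repeated factor, and that letter determines \<open>w ! (j + i)\<close>.\<close>
        define e where "e = a * j + (a - 1) - s + a * i"
        have "a * i + a \<le> a * (k * (a - b))" using i by (metis Suc_leI mult_Suc_right mult_le_mono2 add.commute)
        then have "e < m * (a - b)" using s by (simp add: e_def k mult.assoc)
        then have "?u ! (s + e) = ?u ! (s + b * m + e)" using eq by blast
        moreover have "s + e = a * (j + i) + (a - 1)"
          using s by (simp add: e_def algebra_simps)
        moreover have "s + b * m + e = a * (j + b * k + i) + (a - 1)"
          using s by (simp add: e_def k algebra_simps)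
        ultimately show ?thesis using morph_last[of "j + i" w] morph_last[of "j + b * k + i" w] ik
          by simp
      qed
      moreover have "0 < k" using m k by simp
      ultimately show False using free in_w unfolding power_free_iff[OF ab(1,2)] by blast
    qed
  qed
qed

end

theorem theorem4p8:
  fixes a b :: nat
  assumes "0 < a" and "0 < b" and "coprime a b"
    and "6 / 5 < real a / real b" and "real a / real b < 5 / 4"
    and "real a / real b \<notin> {11 / 9, 17 / 14}"
  shows "uniform_morphism a (phi a b) \<and>
         locates_words a (phi a b) a \<and>
         power_free_morphism a b (phi a b)"
proof -
  have "6 * real b < 5 * real a" "4 * real a < 5 * real b"
      "9 * real a \<noteq> 11 * real b" "14 * real a \<noteq> 17 * real b"
    using assms by (auto simp: field_simps)
  then interpret power_range a b by unfold_locales linarith+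
  show ?thesis using uniform_phi locates_phi power_free_phi[OF assms(3)] by blast
qed

end
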